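(* Let $\kappa \in \{2,3,4,\ldots,\omega,\omega_1\}$. If a function $g\colon \mathbb{N} \to \mathbb{N}$ has a $\kappa$-fold Diophantine representation, then $g(n) < h_{\kappa}(n)$ for every sufficiently large integer $n$.
   Context: $\mathbb{N}$ denotes the set of non-negative integers; $\omega$ is the least infinite cardinal and $\omega_1$ the least uncountable cardinal. A set $\mathcal{M} \subseteq \mathbb{N}^p$ has a $\kappa$-fold Diophantine representation if there is a polynomial $W$ with integer coefficients such that for all $(a_1,\ldots,a_p)\in\mathbb{N}^p$: $(a_1,\ldots,a_p) \in \mathcal{M}$ iff there exist $x_1,\ldots,x_m \in \mathbb{N}$ with $W(a_1,\ldots,a_p,x_1,\ldots,x_m)=0$, and moreover for all $a_1,\ldots,a_p \in \mathbb{N}$ the equation $W(a_1,\ldots,a_p,x_1,\ldots,x_m)=0$ has fewer than $\kappa$ solutions $(x_1,\ldots,x_m)\in\mathbb{N}^m$. A function $g\colon\mathbb{N}\to\mathbb{N}$ has a $\kappa$-fold Diophantine representation if its graph $\{(x,g(x))\colon x\in\mathbb{N}\}\subseteq\mathbb{N}^2$ does. For a positive integer $n$, let $B(\kappa,n)$ be the set of all polynomials $D(x,x_1,\ldots,x_i)$ with integer coefficients such that: the total degree of $D$ is at most $n$; every coefficient of $D$ lies in $[-n,n]$; $i \leq n$; for each non-negative integer $j$ the equation $D(j,x_1,\ldots,x_i)=0$ is solvable in non-negative integers $x_1,\ldots,x_i$; and for each non-negative integer $j$ the equation $D(j,x_1,\ldots,x_i)=0$ has fewer than $\kappa$ solutions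 in non-negative integers $x_1,\ldots,x_i$. Then $h_\kappa(n)$ denotes the smallest non-negative integer $b$ such that for each polynomial $D(x,x_1,\ldots,x_i) \in B(\kappa,n)$ the equation $D(n,x_1,\ldots,x_i)=0$ has a solution in non-negative integers $x_1,\ldots,x_i$ all not greater than $b$. *)

theory Defs
  imports "HOL-Library.Poly_Mapping"
begin

unbundle cardinal_syntax

text \<open>Integer polynomials in variables indexed by \<^typ>\<open>nat\<close>: a finitely supported map from
  exponent vectors to coefficients.\<close>

type_synonym int_mpoly = "(nat \<Rightarrow>\<^sub>0 nat) \<Rightarrow>\<^sub>0 int"

definition mpoly_vars :: "int_mpoly \<Rightarrow> nat set" where
  "mpoly_vars P = (\<Union>m\<in>Poly_Mapping.keys P. Poly_Mapping.keys m)"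

text \<open>The zero polynomial gets total degree 0.\<close>

definition mpoly_total_degree :: "int_mpoly \<Rightarrow> nat" where
  "mpoly_total_degree P =
     Max (insert 0 ((\<lambda>m. \<Sum>v\<in>Poly_Mapping.keys m. Poly_Mapping.lookup m v) ` Poly_Mapping.keys P))"

text \<open>Variable \<open>v\<close> is given the value \<open>xs ! v\<close>; meaningful only if all variables of \<open>P\<close> are below
  \<^term>\<open>length xs\<close>.\<close>

definition mpoly_eval :: "int_mpoly \<Rightarrow> nat list \<Rightarrow> int" where
  "mpoly_eval P xs =
     (\<Sum>m\<in>Poly_Mapping.keys P.
        Poly_Mapping.lookup P m *
        (\<Prod>v\<in>Poly_Mapping.keys m. int (xs ! v) ^ Poly_Mapping.lookup m v))"

text \<open>The solutions \<open>(x\<^sub>1,\<dots>,x\<^sub>m)\<close> in non-negative integers of \<open>P(a\<^sub>1,\<dots>,a\<^sub>p,x\<^sub>1,\<dots>,x\<^sub>m) = 0\<close>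
  for fixed parameters \<open>a\<close>. The number \<open>m\<close> of unknowns is explicit because a polynomial in \<open>m\<close>
  unknowns need not involve all of them.\<close>

definition solutions :: "int_mpoly \<Rightarrow> nat list \<Rightarrow> nat \<Rightarrow> nat list set" where
  "solutions P a m = {xs. length xs = m \<and> mpoly_eval P (a @ xs) = 0}"

text \<open>Cardinals are represented, as in the BNF cardinal library, by minimal well-orders, up to
  \<open>=o\<close>. Here \<^term>\<open>natLeq\<close> is \<open>\<omega>\<close> and \<^term>\<open>cardSuc natLeq\<close> is \<open>\<omega>\<^sub>1\<close>.\<close>

definition admissible_kappa :: "'k rel \<Rightarrow> bool" where
  "admissible_kappa \<kappa> \<longleftrightarrow>
     (\<exists>k::nat. 2 \<le> k \<and> \<kappa> =o |{..<k}| ) \<or> \<kappa> =o natLeq \<or> \<kappa> =o cardSuc natLeq"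

definition fold_diophantine :: "'k rel \<Rightarrow> nat \<Rightarrow> nat list set \<Rightarrow> bool" where
  "fold_diophantine \<kappa> p M \<longleftrightarrow>
     M \<subseteq> {a. length a = p} \<and>
     (\<exists>m W. mpoly_vars W \<subseteq> {..<p + m} \<and>
        (\<forall>a. length a = p \<longrightarrow> (a \<in> M \<longleftrightarrow> (\<exists>xs. xs \<in> solutions W a m))) \<and>
        (\<forall>a. length a = p \<longrightarrow> |solutions W a m| <o \<kappa>))"

definition fold_diophantine_fun :: "'k rel \<Rightarrow> (nat \<Rightarrow> nat) \<Rightarrow> bool" where
  "fold_diophantine_fun \<kappa> g \<longleftrightarrow> fold_diophantine \<kappa> 2 {[x, g x] | x. True}"

text \<open>An element \<open>(i, D)\<close> is a polynomial \<open>D(x,x\<^sub>1,\<dots>,x\<^sub>i)\<close>; variable 0 is the parameter \<open>x\<close>.\<close>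

definition B :: "'k rel \<Rightarrow> nat \<Rightarrow> (nat \<times> int_mpoly) set" where
  "B \<kappa> n = {(i, D).
     mpoly_vars D \<subseteq> {..i} \<and>
     mpoly_total_degree D \<le> n \<and>
     (\<forall>m. Poly_Mapping.lookup D m \<in> {- int n..int n}) \<and>
     i \<le> n \<and>
     (\<forall>j. \<exists>xs. xs \<in> solutions D [j] i) \<and>
     (\<forall>j. |solutions D [j] i| <o \<kappa>)}"

definition h :: "'k rel \<Rightarrow> nat \<Rightarrow> nat" where
  "h \<kappa> n = (LEAST b. \<forall>(i, D) \<in> B \<kappa> n. \<exists>xs \<in> solutions D [n] i. \<forall>x \<in> set xs. x \<le> b)"

end

theory Submission
  imports Defs
begin

text \<open>If \<open>W(x, y, x\<^sub>1, \<dots>, x\<^sub>m)\<close> represents the graph of \<open>g\<close>, then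
  \<open>D = W\<^sup>2 + (z - y - 1)\<^sup>2\<close>, with parameter \<open>x\<close> and unknowns \<open>y, x\<^sub>1, \<dots>, x\<^sub>m, z\<close>, vanishes exactly
  when \<open>y = g x\<close>, \<open>z = g x + 1\<close> and \<open>W\<close> vanishes; its solutions for \<open>x = j\<close> thus correspond to
  those of \<open>W(j, g j, \<dots>) = 0\<close>. Hence \<open>D\<close> belongs to \<open>B(\<kappa>, n)\<close> for all large \<open>n\<close>, and each solution
  for \<open>x = n\<close> has \<open>g n + 1\<close> among its entries. The minimum defining \<open>h\<close> exists because \<open>B(\<kappa>, n)\<close>
  is finite.\<close>

section \<open>Evaluation respects the ring operations\<close>

definition monom_eval :: "nat list \<Rightarrow> (nat \<Rightarrow>\<^sub>0 nat) \<Rightarrow> int" where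
  "monom_eval xs m = (\<Prod>v\<in>Poly_Mapping.keys m. int (xs ! v) ^ Poly_Mapping.lookup m v)"

lemma mpoly_eval_eq_sum_monom_eval:
  "mpoly_eval P xs = (\<Sum>m\<in>Poly_Mapping.keys P. Poly_Mapping.lookup P m * monom_eval xs m)"
  by (simp add: mpoly_eval_def monom_eval_def)

text \<open>An index outside the support contributes a power with exponent 0, hence the factor 1.
  Monomials with different supports can thus be compared over a common index set.\<close>

lemma monom_eval_superset:
  assumes "finite S" "Poly_Mapping.keys m \<subseteq> S"
  shows "monom_eval xs m = (\<Prod>v\<in>S. int (xs ! v) ^ Poly_Mapping.lookup m v)"
  unfolding monom_eval_def
  by (rule prod.mono_neutral_left) (use assms in \<open>auto simp: in_keys_iff\<close>)

lemma mpoly_eval_superset: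
  assumes "finite S" "Poly_Mapping.keys P \<subseteq> S"
  shows "mpoly_eval P xs = (\<Sum>m\<in>S. Poly_Mapping.lookup P m * monom_eval xs m)"
  unfolding mpoly_eval_eq_sum_monom_eval
  by (rule sum.mono_neutral_left) (use assms in \<open>auto simp: in_keys_iff\<close>)

lemma monom_eval_add: "monom_eval xs (m + m') = monom_eval xs m * monom_eval xs m'"
proof -
  let ?S = "Poly_Mapping.keys m \<union> Poly_Mapping.keys m'"
  have "Poly_Mapping.keys (m + m') \<subseteq> ?S"
    by (rule Poly_Mapping.keys_add)
  then show ?thesis
    by (simp add: monom_eval_superset[of ?S] lookup_add power_add prod.distrib)
qed

lemma mpoly_eval_add: "mpoly_eval (P + Q) xs = mpoly_eval P xs + mpoly_eval Q xs"
proof -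
  let ?S = "Poly_Mapping.keys P \<union> Poly_Mapping.keys Q"
  have "Poly_Mapping.keys (P + Q) \<subseteq> ?S"
    by (rule Poly_Mapping.keys_add)
  then show ?thesis
    by (simp add: mpoly_eval_superset[of ?S] lookup_add sum.distrib algebra_simps)
qed

lemma mpoly_eval_diff: "mpoly_eval (P - Q) xs = mpoly_eval P xs - mpoly_eval Q xs"
  using mpoly_eval_add[of "P - Q" Q xs] by simp

lemma mpoly_eval_zero [simp]: "mpoly_eval 0 xs = 0"
  by (simp add: mpoly_eval_def)

lemma mpoly_eval_sum: "mpoly_eval (sum f A) xs = (\<Sum>a\<in>A. mpoly_eval (f a) xs)"
  by (induction A rule: infinite_finite_induct) (simp_all add: mpoly_eval_add)

lemma mpoly_eval_single [simp]: "mpoly_eval (Poly_Mapping.single m c) xs = c * monom_eval xs m"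
  by (simp add: mpoly_eval_eq_sum_monom_eval)

text \<open>Reduces multiplicativity of evaluation to products of single terms.\<close>

lemma mpoly_eq_sum_single:
  fixes P :: int_mpoly
  shows "P = (\<Sum>m\<in>Poly_Mapping.keys P. Poly_Mapping.single m (Poly_Mapping.lookup P m))"
  by (rule poly_mapping_eqI)
     (auto simp: lookup_sum lookup_single when_def in_keys_iff)

lemma mpoly_eval_mult: "mpoly_eval (P * Q) xs = mpoly_eval P xs * mpoly_eval Q xs"
proof -
  have "P * Q = (\<Sum>m\<in>Poly_Mapping.keys P. \<Sum>m'\<in>Poly_Mapping.keys Q.
      Poly_Mapping.single (m + m') (Poly_Mapping.lookup P m * Poly_Mapping.lookup Q m'))"
    using arg_cong2[where f = "(*)", OF mpoly_eq_sum_single[of P] mpoly_eq_sum_single[of Q]]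
    by (simp only: sum_product mult_single)
  then have "mpoly_eval (P * Q) xs = (\<Sum>m\<in>Poly_Mapping.keys P. \<Sum>m'\<in>Poly_Mapping.keys Q.
      (Poly_Mapping.lookup P m * Poly_Mapping.lookup Q m') * monom_eval xs (m + m'))"
    by (simp add: mpoly_eval_sum)
  also have "\<dots> = mpoly_eval P xs * mpoly_eval Q xs"
    by (simp add: mpoly_eval_eq_sum_monom_eval sum_product monom_eval_add mult_ac)
  finally show ?thesis .
qed

lemma mpoly_eval_one [simp]: "mpoly_eval 1 xs = 1"
  using mpoly_eval_single[of 0 1 xs] by (simp add: monom_eval_def)

definition mpoly_var :: "nat \<Rightarrow> int_mpoly" where
  "mpoly_var v = Poly_Mapping.single (Poly_Mapping.single v 1) 1"

lemma mpoly_eval_var [simp]: "mpoly_eval (mpoly_var v) xs = int (xs ! v)"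
  by (simp add: mpoly_var_def monom_eval_def)

lemma mpoly_eval_cong:
  assumes "\<And>v. v \<in> mpoly_vars P \<Longrightarrow> xs ! v = ys ! v"
  shows "mpoly_eval P xs = mpoly_eval P ys"
  unfolding mpoly_eval_def
  using assms
  by (intro sum.cong prod.cong arg_cong2[where f = "(*)"] arg_cong2[where f = "(^)"] refl)
     (auto simp: mpoly_vars_def)

section \<open>Variables of sums, differences and products\<close>

lemma mpoly_vars_add: "mpoly_vars (P + Q) \<subseteq> mpoly_vars P \<union> mpoly_vars Q"
  using Poly_Mapping.keys_add[of P Q] unfolding mpoly_vars_def by blast

lemma mpoly_vars_diff: "mpoly_vars (P - Q) \<subseteq> mpoly_vars P \<union> mpoly_vars Q"
  using Poly_Mapping.keys_diff[of P Q] unfolding mpoly_vars_def by blast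

lemma mpoly_vars_mult: "mpoly_vars (P * Q) \<subseteq> mpoly_vars P \<union> mpoly_vars Q"
proof
  fix v
  assume "v \<in> mpoly_vars (P * Q)"
  then obtain m where "m \<in> Poly_Mapping.keys (P * Q)" and v: "v \<in> Poly_Mapping.keys m"
    by (auto simp: mpoly_vars_def)
  then obtain a b where "m = a + b" "a \<in> Poly_Mapping.keys P" "b \<in> Poly_Mapping.keys Q"
    using Poly_Mapping.keys_mult[of P Q] by blast
  with v show "v \<in> mpoly_vars P \<union> mpoly_vars Q"
    using Poly_Mapping.keys_add[of a b] by (auto simp: mpoly_vars_def)
qed

lemma mpoly_vars_var [simp]: "mpoly_vars (mpoly_var v) = {v}"
  by (simp add: mpoly_vars_def mpoly_var_def)

lemma mpoly_vars_one [simp]: "mpoly_vars 1 = {}"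
  by (simp add: mpoly_vars_def)

section \<open>Finiteness of \<open>B\<close> and existence of the bound \<open>h\<close>\<close>

lemma finite_poly_mapping_bounded:
  fixes A :: "'a set" and C :: "'b::zero set"
  assumes "finite A" "finite C"
  shows "finite {f :: 'a \<Rightarrow>\<^sub>0 'b. Poly_Mapping.keys f \<subseteq> A \<and> (\<forall>x. Poly_Mapping.lookup f x \<in> C)}"
proof (rule finite_imageD)
  show "finite (Poly_Mapping.lookup `
      {f :: 'a \<Rightarrow>\<^sub>0 'b. Poly_Mapping.keys f \<subseteq> A \<and> (\<forall>x. Poly_Mapping.lookup f x \<in> C)})"
    by (rule finite_subset[OF _ finite_set_of_finite_funs[OF assms, of 0]])
       (auto simp: in_keys_iff subset_iff)
qed (simp add: inj_on_def lookup_inject)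

lemma lookup_le_mpoly_total_degree:
  assumes "m \<in> Poly_Mapping.keys P"
  shows "Poly_Mapping.lookup m v \<le> mpoly_total_degree P"
proof (cases "v \<in> Poly_Mapping.keys m")
  case True
  then have "Poly_Mapping.lookup m v \<le> (\<Sum>v\<in>Poly_Mapping.keys m. Poly_Mapping.lookup m v)"
    by (intro member_le_sum) auto
  also have "\<dots> \<le> mpoly_total_degree P"
    unfolding mpoly_total_degree_def using assms by (intro Max_ge) auto
  finally show ?thesis .
qed (simp add: in_keys_iff)

text \<open>The boundedness lemma is used at two levels: for exponent vectors, whose entries are at
  most the total degree, and then for polynomials over these finitely many monomials.\<close>

lemma finite_B: "finite (B \<kappa> n)"
proof -
  let ?M = "{m :: nat \<Rightarrow>\<^sub>0 nat. Poly_Mapping.keys m \<subseteq> {..n} \<and> (\<forall>v. Poly_Mapping.lookup m v \<in> {..n})}"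
  let ?P = "{D :: int_mpoly. Poly_Mapping.keys D \<subseteq> ?M \<and>
      (\<forall>m. Poly_Mapping.lookup D m \<in> {- int n..int n})}"
  have "finite ?P"
    by (intro finite_poly_mapping_bounded) auto
  moreover have "B \<kappa> n \<subseteq> {..n} \<times> ?P"
  proof (clarify, intro SigmaI CollectI conjI subsetI)
    fix i D
    assume D: "(i, D) \<in> B \<kappa> n"
    then show "i \<in> {..n}" "\<forall>m. Poly_Mapping.lookup D m \<in> {- int n..int n}"
      by (auto simp: B_def)
    fix m
    assume m: "m \<in> Poly_Mapping.keys D"
    show "\<forall>v. Poly_Mapping.lookup m v \<in> {..n}"
      using D lookup_le_mpoly_total_degree[OF m] by (auto simp: B_def intro: order_trans)
    fix v
    assume "v \<in> Poly_Mapping.keys m"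
    with m have "v \<in> mpoly_vars D"
      by (auto simp: mpoly_vars_def)
    with D show "v \<in> {..n}"
      by (auto simp: B_def)
  qed
  ultimately show ?thesis
    by (meson finite_SigmaI finite_atMost finite_subset)
qed

lemma h_bounds_solution:
  assumes "(i, D) \<in> B \<kappa> n"
  shows "\<exists>xs \<in> solutions D [n] i. \<forall>x \<in> set xs. x \<le> h \<kappa> n"
proof -
  let ?bd = "\<lambda>b. \<forall>(i, D) \<in> B \<kappa> n. \<exists>xs \<in> solutions D [n] i. \<forall>x \<in> set xs. x \<le> b"
  have "\<forall>p \<in> B \<kappa> n. \<exists>xs. xs \<in> solutions (snd p) [n] (fst p)"
    by (auto simp: B_def)
  then obtain s where s: "\<And>p. p \<in> B \<kappa> n \<Longrightarrow> s p \<in> solutions (snd p) [n] (fst p)"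
    by metis
  let ?U = "\<Union>p\<in>B \<kappa> n. set (s p)"
  have "finite ?U"
    by (simp add: finite_B)
  \<comment> \<open>\<open>?U\<close> collects the entries of one chosen solution per polynomial. If
    it is empty, \<open>Max ?U\<close> is unspecified, but then there is no entry to bound.\<close>
  then have "x \<le> Max ?U" if "p \<in> B \<kappa> n" "x \<in> set (s p)" for p x
    by (rule Max_ge) (use that in blast)
  then have "?bd (Max ?U)"
    using s by (intro ballI prod.case_eq_if[THEN iffD2] bexI) auto
  then have "?bd (h \<kappa> n)"
    unfolding h_def by (rule LeastI)
  with assms show ?thesis
    by auto
qed

section \<open>The polynomial \<open>D\<close> and its membership in \<open>B\<close> for large
  \<open>n\<close>\<close>

lemma eventually_mem_B:
  fixes D :: int_mpoly
  assumes "mpoly_vars D \<subseteq> {..i}"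
    and "\<And>j. \<exists>xs. xs \<in> solutions D [j] i"
    and "\<And>j. |solutions D [j] i| <o \<kappa>"
  shows "\<exists>N. \<forall>n\<ge>N. (i, D) \<in> B \<kappa> n"
proof (intro exI allI impI)
  \<comment> \<open>\<open>?c\<close> dominates every coefficient in absolute value. The threshold
    \<open>N\<close> is the sum below, so that \<open>n\<close> exceeds or equals each of its three
    summands.\<close>
  let ?c = "\<Sum>m\<in>Poly_Mapping.keys D. nat \<bar>Poly_Mapping.lookup D m\<bar>"
  fix n
  assume n: "i + mpoly_total_degree D + ?c \<le> n"
  have "Poly_Mapping.lookup D m \<in> {- int n..int n}" for m
  proof (cases "m \<in> Poly_Mapping.keys D")
    case True
    then have "nat \<bar>Poly_Mapping.lookup D m\<bar> \<le> ?c"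
      by (intro member_le_sum) auto
    with n show ?thesis
      by auto
  qed (simp add: in_keys_iff)
  with assms n show "(i, D) \<in> B \<kappa> n"
    by (auto simp: B_def)
qed

text \<open>Variable 0 is the parameter \<open>x\<close>, 1 is \<open>y\<close>, 2 to
  \<open>m + 1\<close> are the other unknowns of \<open>W\<close>, and \<open>m + 2\<close> is the
  new unknown \<open>z\<close>.\<close>

definition succ_witness_poly :: "nat \<Rightarrow> int_mpoly \<Rightarrow> int_mpoly" where
  "succ_witness_poly m W =
     W * W + (mpoly_var (m + 2) - mpoly_var 1 - 1) * (mpoly_var (m + 2) - mpoly_var 1 - 1)"

lemma mpoly_vars_succ_witness_poly:
  assumes "mpoly_vars W \<subseteq> {..<2 + m}"
  shows "mpoly_vars (succ_witness_poly m W) \<subseteq> {..m + 2}"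
proof -
  let ?T = "mpoly_var (m + 2) - mpoly_var 1 - 1"
  have "mpoly_vars ?T \<subseteq> {..m + 2}"
    using mpoly_vars_diff[of "mpoly_var (m + 2) - mpoly_var 1" 1]
      mpoly_vars_diff[of "mpoly_var (m + 2)" "mpoly_var 1"] by auto
  moreover have "mpoly_vars (succ_witness_poly m W) \<subseteq> mpoly_vars W \<union> mpoly_vars ?T"
    unfolding succ_witness_poly_def
    using mpoly_vars_add[of "W * W" "?T * ?T"] mpoly_vars_mult[of W W] mpoly_vars_mult[of ?T ?T]
    by blast
  ultimately show ?thesis
    using assms by fastforce
qed

text \<open>Describing the solution set as an image transfers both solvability and the cardinality
  bound from \<open>W\<close>, and displays the entry \<open>Suc (g j)\<close>.\<close>

lemma solutions_succ_witness_poly: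
  assumes vars: "mpoly_vars W \<subseteq> {..<2 + m}"
    and graph: "\<And>y. (\<exists>xs. xs \<in> solutions W [j, y] m) \<longleftrightarrow> y = g j"
  shows "solutions (succ_witness_poly m W) [j] (m + 2) =
    (\<lambda>xs. g j # xs @ [Suc (g j)]) ` solutions W [j, g j] m"
proof -
  have eval: "mpoly_eval (succ_witness_poly m W) (j # y # xs @ [z]) = 0 \<longleftrightarrow>
      mpoly_eval W (j # y # xs) = 0 \<and> z = Suc y"
    if "length xs = m" for y xs z
  proof -
    \<comment> \<open>The entry \<open>z\<close> has index \<open>m + 2\<close>, beyond all
      variables of \<open>W\<close>.\<close>
    have "mpoly_eval W (j # y # xs @ [z]) = mpoly_eval W (j # y # xs)"
      by (rule mpoly_eval_cong) (use vars that in \<open>auto simp: nth_Cons nth_append split: nat.splits\<close>)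
    then show ?thesis
      using that
      by (auto simp: succ_witness_poly_def mpoly_eval_add mpoly_eval_mult mpoly_eval_diff
          nth_append sum_squares_eq_zero_iff)
  qed
  show ?thesis
  proof (intro equalityI subsetI)
    fix ys
    assume ys: "ys \<in> solutions (succ_witness_poly m W) [j] (m + 2)"
    then have "length ys = Suc (Suc m)"
      by (simp add: solutions_def)
    \<comment> \<open>With at least two entries, the first and the last are distinct positions even
      for \<open>m = 0\<close>.\<close>
    then obtain y zs where "ys = y # zs" "length zs = Suc m"
      by (auto simp: length_Suc_conv)
    then obtain xs z where eq: "ys = y # xs @ [z]" and len: "length xs = m"
      by (metis length_Suc_conv_rev)
    with ys eval have "xs \<in> solutions W [j, y] m" "z = Suc y"
      by (auto simp: solutions_def)
    moreover from this graph have "y = g j"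
      by blast
    ultimately show "ys \<in> (\<lambda>xs. g j # xs @ [Suc (g j)]) ` solutions W [j, g j] m"
      using eq by simp
  qed (use eval in \<open>auto simp: solutions_def\<close>)
qed

theorem theorem6:
  fixes \<kappa> :: "'k rel" and g :: "nat \<Rightarrow> nat"
  assumes "admissible_kappa \<kappa>"
    and "fold_diophantine_fun \<kappa> g"
  shows "\<exists>N. \<forall>n\<ge>N. g n < h \<kappa> n"
proof -
  obtain m W where vars: "mpoly_vars W \<subseteq> {..<2 + m}"
    and rep: "\<And>a. length a = 2 \<Longrightarrow>
      a \<in> {[x, g x] | x. True} \<longleftrightarrow> (\<exists>xs. xs \<in> solutions W a m)"
    and card: "\<And>a. length a = 2 \<Longrightarrow> |solutions W a m| <o \<kappa>"
    using assms(2) unfolding fold_diophantine_fun_def fold_diophantine_def by blast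
  let ?D = "succ_witness_poly m W"
  have graph: "(\<exists>xs. xs \<in> solutions W [j, y] m) \<longleftrightarrow> y = g j" for j y
    using rep[of "[j, y]"] by auto
  note sol = solutions_succ_witness_poly[of W m _ g, OF vars graph]
  \<comment> \<open>Passing to an image does not increase the cardinal.\<close>
  have "|solutions ?D [j] (m + 2)| <o \<kappa>" for j
    unfolding sol by (rule ordLeq_ordLess_trans[OF card_of_image card]) simp
  moreover have "\<exists>xs. xs \<in> solutions ?D [j] (m + 2)" for j
    unfolding sol using graph[of j "g j"] by blast
  ultimately obtain N where N: "\<And>n. n \<ge> N \<Longrightarrow> (m + 2, ?D) \<in> B \<kappa> n"
    using eventually_mem_B mpoly_vars_succ_witness_poly[OF vars] by metis
  \<comment> \<open>The bound \<open>h\<close> is non-strict; applied to the entry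
    \<open>Suc (g n)\<close> it gives the strict inequality.\<close>
  have "g n < h \<kappa> n" if "n \<ge> N" for n
    using h_bounds_solution[OF N[OF that]] unfolding sol by auto
  then show ?thesis
    by blast
qed

end
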